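(* Let $(x_n)$ be defined by $x_n=2x_{n-1}+2x_{n-2}+x_{n-3}$ with $x_0=0$, $x_1=1$, $x_2=2$. The only solutions of the equation $x_n=m!$ in positive integers $n,m$ are $(n,m)\in\{(1,1),(2,2),(3,3)\}$. *)

theory Defs
  imports Main
begin

fun x_seq :: "nat \<Rightarrow> nat" where
  "x_seq 0 = 0"
| "x_seq (Suc 0) = 1"
| "x_seq (Suc (Suc 0)) = 2"
| "x_seq (Suc (Suc (Suc n))) = 2 * x_seq (Suc (Suc n)) + 2 * x_seq (Suc n) + x_seq n"

end

theory Submission
  imports Defs "HOL-Computational_Algebra.Primes"
begin

text \<open>
  Modulo 5 every solution of the recurrence has period 8. Expanding \<open>(1 + \<Delta>) ^ p\<close>, where
  \<open>\<Delta> u = u (\<cdot> + T) - u\<close>, shows that passing from a period \<open>T\<close> to \<open>p * T\<close> multiplies \<open>\<Delta>\<close> by \<open>p\<close> up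
  to terms of higher \<open>p\<close>-adic order. Hence modulo \<open>5 ^ (k + 1)\<close> the period is \<open>8 * 5 ^ k\<close>, and, as
  in Hensel's lemma, the two simple zeros \<open>x\<^sub>0 = x\<^sub>-\<^sub>1 = 0\<close> lift uniquely, so that \<open>x\<^sub>n\<close> vanishes modulo
  \<open>5 ^ (k + 1)\<close> only if \<open>n \<equiv> 0\<close> or \<open>n \<equiv> -1\<close> modulo \<open>8 * 5 ^ k\<close>. Since \<open>5 ^ (m div 5)\<close> divides \<open>m!\<close>, a
  solution of \<open>x\<^sub>n = m!\<close> has \<open>n + 1 \<ge> 8 * 5 ^ (m div 5 - 1)\<close> if \<open>m \<ge> 5\<close>, and then \<open>x\<^sub>n > 2 ^ n\<close>
  exceeds \<open>m!\<close> as soon as \<open>m \<ge> 10\<close>.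
\<close>

section \<open>Iterated differences of linear recurrences\<close>

definition shift_diff :: "nat \<Rightarrow> (nat \<Rightarrow> 'a::ab_group_add) \<Rightarrow> nat \<Rightarrow> 'a" where
  "shift_diff T u n = u (n + T) - u n"

lemma shift_diff_scale:
  fixes c :: "'a::ring"
  shows "shift_diff T (\<lambda>n. c * u n) = (\<lambda>n. c * shift_diff T u n)"
  by (simp add: shift_diff_def right_diff_distrib fun_eq_iff)

lemma newton_forward_difference:
  fixes u :: "nat \<Rightarrow> 'a::comm_ring_1"
  shows "u (n + m * T) = (\<Sum>i\<le>m. of_nat (m choose i) * (shift_diff T ^^ i) u n)"
proof (induction m arbitrary: n)
  case 0
  then show ?case by simp
next
  case (Suc m)
  let ?D = "\<lambda>i. (shift_diff T ^^ i) u n"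
  have shift: "(shift_diff T ^^ i) u (n + T) = ?D i + ?D (Suc i)" for i
    by (simp add: shift_diff_def)
  have "u (n + Suc m * T) = u ((n + T) + m * T)"
    by (simp add: ac_simps)
  also have "\<dots> = (\<Sum>i\<le>m. of_nat (m choose i) * ?D i) + (\<Sum>i\<le>m. of_nat (m choose i) * ?D (Suc i))"
    by (simp only: Suc.IH shift distrib_left sum.distrib)
  also have "(\<Sum>i\<le>m. of_nat (m choose i) * ?D i) = (\<Sum>i\<le>Suc m. of_nat (m choose i) * ?D i)"
    by (simp add: binomial_eq_0)
  also have "\<dots> = ?D 0 + (\<Sum>i\<le>m. of_nat (m choose Suc i) * ?D (Suc i))"
    by (subst sum.atMost_Suc_shift) simp
  also have "\<dots> + (\<Sum>i\<le>m. of_nat (m choose i) * ?D (Suc i)) =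
      (\<Sum>i\<le>Suc m. of_nat (Suc m choose i) * ?D i)"
    by (simp add: sum.atMost_Suc_shift sum.distrib distrib_right add_ac
        del: sum.atMost_Suc funpow.simps)
  finally show ?case .
qed

definition linear_recurrence :: "'a::comm_ring_1 list \<Rightarrow> (nat \<Rightarrow> 'a) \<Rightarrow> bool" where
  "linear_recurrence cs u \<longleftrightarrow> (\<forall>n. u (n + length cs) = (\<Sum>i<length cs. cs ! i * u (n + i)))"

lemma linear_recurrence_shift_diff:
  assumes "linear_recurrence cs u"
  shows "linear_recurrence cs (shift_diff T u)"
  unfolding linear_recurrence_def
proof
  fix n
  have rec: "u (i + length cs) = (\<Sum>j<length cs. cs ! j * u (i + j))" for i
    using assms unfolding linear_recurrence_def by blast
  show "shift_diff T u (n + length cs) = (\<Sum>i<length cs. cs ! i * shift_diff T u (n + i))"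
    using rec[of n] rec[of "n + T"]
    by (simp add: shift_diff_def right_diff_distrib sum_subtractf ac_simps)
qed

lemma linear_recurrence_cancel:
  fixes d :: "'a::idom"
  assumes "linear_recurrence cs (\<lambda>n. d * z n)" and "d \<noteq> 0"
  shows "linear_recurrence cs z"
  unfolding linear_recurrence_def
proof
  fix n
  have "d * z (n + length cs) = (\<Sum>i<length cs. cs ! i * (d * z (n + i)))"
    using assms(1) unfolding linear_recurrence_def by blast
  also have "\<dots> = d * (\<Sum>i<length cs. cs ! i * z (n + i))"
    by (simp add: sum_distrib_left mult.left_commute)
  finally show "z (n + length cs) = (\<Sum>i<length cs. cs ! i * z (n + i))"
    using assms(2) by simp
qed

section \<open>Periods of a linear recurrence modulo powers of an odd number\<close>

definition period_mod :: "'a::comm_ring_1 list \<Rightarrow> 'a \<Rightarrow> nat \<Rightarrow> bool" where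
  "period_mod cs d T \<longleftrightarrow> (\<forall>u n. linear_recurrence cs u \<longrightarrow> d dvd shift_diff T u n)"

lemma period_modD:
  "period_mod cs d T \<Longrightarrow> linear_recurrence cs u \<Longrightarrow> d dvd shift_diff T u n"
  unfolding period_mod_def by blast

lemma shift_diff_eq_scaled_recurrence:
  fixes d :: "'a::idom"
  assumes "period_mod cs d T" and "linear_recurrence cs u"
  obtains z where "linear_recurrence cs z" and "shift_diff T u = (\<lambda>n. d * z n)"
proof (cases "d = 0")
  case True
  have "shift_diff T u = (\<lambda>n. d * 0)"
    using period_modD[OF assms] True by auto
  moreover have "linear_recurrence cs (\<lambda>n. 0)"
    by (simp add: linear_recurrence_def)
  ultimately show ?thesis using that by blast
next
  case False
  have "\<forall>n. \<exists>c. shift_diff T u n = d * c"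
    using period_modD[OF assms] by (auto simp: dvd_def)
  then obtain z where z: "shift_diff T u = (\<lambda>n. d * z n)"
    by metis
  then have "linear_recurrence cs z"
    using linear_recurrence_shift_diff[OF assms(2), of T] False
    by (auto intro: linear_recurrence_cancel)
  with z show ?thesis using that by blast
qed

lemma power_dvd_shift_diff_funpow:
  fixes d :: "'a::idom"
  assumes "period_mod cs d T" and "linear_recurrence cs u"
  shows "d ^ i dvd (shift_diff T ^^ i) u n"
proof -
  have "\<exists>z. linear_recurrence cs z \<and> (shift_diff T ^^ i) u = (\<lambda>n. d ^ i * z n)"
  proof (induction i)
    case 0
    then show ?case using assms(2) by auto
  next
    case (Suc i)
    then obtain z where z: "linear_recurrence cs z" "(shift_diff T ^^ i) u = (\<lambda>n. d ^ i * z n)"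
      by blast
    obtain y where y: "linear_recurrence cs y" "shift_diff T z = (\<lambda>n. d * y n)"
      using shift_diff_eq_scaled_recurrence[OF assms(1) z(1)] .
    have "(shift_diff T ^^ Suc i) u = (\<lambda>n. d ^ Suc i * y n)"
      by (simp add: z(2) shift_diff_scale y(2) mult.left_commute mult.assoc)
    with y(1) show ?case by blast
  qed
  then show ?thesis by auto
qed

lemma newton_truncated_mod_power:
  fixes d :: "'a::idom"
  assumes "period_mod cs d T" and "linear_recurrence cs u"
  shows "d ^ r dvd u (n + m * T) - (\<Sum>i<r. of_nat (m choose i) * (shift_diff T ^^ i) u n)"
proof -
  let ?t = "\<lambda>i. of_nat (m choose i) * (shift_diff T ^^ i) u n"
  have "u (n + m * T) = sum ?t {..m}"
    by (rule newton_forward_difference)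
  also have "\<dots> = sum ?t {..<r + Suc m}"
    by (rule sum.mono_neutral_left) (auto simp: binomial_eq_0)
  also have "{..<r + Suc m} = {..<r} \<union> {r..<r + Suc m}"
    by auto
  also have "sum ?t \<dots> = sum ?t {..<r} + sum ?t {r..<r + Suc m}"
    by (rule sum.union_disjoint) auto
  finally have "u (n + m * T) - sum ?t {..<r} = sum ?t {r..<r + Suc m}"
    by simp
  moreover have "d ^ r dvd ?t i" if "i \<in> {r..<r + Suc m}" for i
    using that power_dvd_shift_diff_funpow[OF assms] by (auto intro!: dvd_mult intro: power_le_dvd)
  ultimately show ?thesis
    by (simp only: dvd_sum)
qed

lemma shift_diff_multiple_mod_square:
  fixes d :: "'a::idom"
  assumes "period_mod cs d T" and "linear_recurrence cs u"
  shows "d ^ 2 dvd shift_diff (m * T) u n - of_nat m * shift_diff T u n"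
  using newton_truncated_mod_power[OF assms, of 2 n m]
  by (simp add: shift_diff_def numeral_2_eq_2 algebra_simps)

lemma shift_diff_odd_multiple_mod_square:
  fixes d :: "'a::idom"
  assumes "period_mod cs d T" and "linear_recurrence cs u" and "odd p" and "of_nat p dvd d"
  shows "of_nat p * d ^ 2 dvd shift_diff (p * T) u n - of_nat p * shift_diff T u n"
proof -
  let ?D2 = "(shift_diff T ^^ 2) u n"
  have "p choose 2 = p * ((p - 1) div 2)"
    using \<open>odd p\<close> by (simp add: choose_two div_mult_swap)
  then have "(of_nat p :: 'a) dvd of_nat (p choose 2)"
    by simp
  then have second_order: "of_nat p * d ^ 2 dvd of_nat (p choose 2) * ?D2"
    using power_dvd_shift_diff_funpow[OF assms(1,2)] by (rule mult_dvd_mono)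
  have "d ^ 3 dvd shift_diff (p * T) u n - of_nat p * shift_diff T u n - of_nat (p choose 2) * ?D2"
    using newton_truncated_mod_power[OF assms(1,2), of 3 n p]
    by (simp add: numeral_3_eq_3 numeral_2_eq_2 diff_diff_eq add.assoc
        shift_diff_def[of "p * T" u])
  moreover have "of_nat p * d ^ 2 dvd d ^ 3"
    using \<open>of_nat p dvd d\<close> by (simp add: power3_eq_cube power2_eq_square mult_dvd_mono)
  ultimately have "of_nat p * d ^ 2 dvd
      shift_diff (p * T) u n - of_nat p * shift_diff T u n - of_nat (p choose 2) * ?D2"
    by (rule dvd_trans[rotated])
  from dvd_add[OF this second_order] show ?thesis
    by simp
qed

lemma period_mod_times:
  fixes d :: "'a::idom"
  assumes "period_mod cs d T" and "of_nat p dvd d"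
  shows "period_mod cs (of_nat p * d) (p * T)"
  unfolding period_mod_def
proof (intro allI impI)
  fix u n
  assume u: "linear_recurrence cs u"
  have "of_nat p * d dvd d ^ 2"
    using assms(2) by (simp add: power2_eq_square mult_dvd_mono)
  then have first_order: "of_nat p * d dvd shift_diff (p * T) u n - of_nat p * shift_diff T u n"
    using shift_diff_multiple_mod_square[OF assms(1) u] by (rule dvd_trans)
  have "of_nat p * d dvd of_nat p * shift_diff T u n"
    using period_modD[OF assms(1) u] by (rule mult_dvd_mono[OF dvd_refl])
  from dvd_add[OF first_order this] show "of_nat p * d dvd shift_diff (p * T) u n"
    by simp
qed

lemma period_mod_power:
  fixes cs :: "'a::idom list"
  assumes "period_mod cs (of_nat p) T"
  shows "period_mod cs (of_nat p ^ Suc k) (p ^ k * T)"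
proof (induction k)
  case 0
  then show ?case using assms by simp
next
  case (Suc k)
  from period_mod_times[OF this, of p] show ?case by (simp add: mult.assoc)
qed

lemma shift_diff_power_multiple:
  fixes u :: "nat \<Rightarrow> 'a::idom"
  assumes "period_mod cs (of_nat p) T" and "linear_recurrence cs u" and "odd p"
  shows "of_nat p ^ (k + 2) dvd shift_diff (p ^ k * T) u n - of_nat p ^ k * shift_diff T u n"
proof (induction k)
  case 0
  then show ?case by simp
next
  case (Suc k)
  let ?p = "of_nat p :: 'a"
  have "?p * (?p ^ Suc k) ^ 2 dvd
      shift_diff (p * (p ^ k * T)) u n - ?p * shift_diff (p ^ k * T) u n"
    using period_mod_power[OF assms(1)] assms(2,3)
    by (rule shift_diff_odd_multiple_mod_square) simp
  moreover have "?p ^ (Suc k + 2) dvd ?p * (?p ^ Suc k) ^ 2"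
    unfolding power_mult[symmetric] power_Suc[symmetric] by (rule le_imp_power_dvd) simp
  ultimately have lift: "?p ^ (Suc k + 2) dvd
      shift_diff (p ^ Suc k * T) u n - ?p * shift_diff (p ^ k * T) u n"
    unfolding power_Suc[of p k] mult.assoc by (rule dvd_trans[rotated])
  have "?p * ?p ^ (k + 2) dvd ?p * (shift_diff (p ^ k * T) u n - ?p ^ k * shift_diff T u n)"
    using Suc.IH by (rule mult_dvd_mono[OF dvd_refl])
  then have scaled_IH: "?p ^ (Suc k + 2) dvd
      ?p * shift_diff (p ^ k * T) u n - ?p ^ Suc k * shift_diff T u n"
    by (simp add: right_diff_distrib mult.assoc)
  from dvd_add[OF lift scaled_IH] show ?case
    by simp
qed

lemma shift_diff_power_times_multiple:
  fixes u :: "nat \<Rightarrow> 'a::idom"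
  assumes "period_mod cs (of_nat p) T" and "linear_recurrence cs u" and "odd p"
  shows "of_nat p ^ (k + 2) dvd
    shift_diff (q * (p ^ k * T)) u n - of_nat (q * p ^ k) * shift_diff T u n"
proof -
  let ?p = "of_nat p :: 'a"
  have "(?p ^ Suc k) ^ 2 dvd
      shift_diff (q * (p ^ k * T)) u n - of_nat q * shift_diff (p ^ k * T) u n"
    using period_mod_power[OF assms(1)] assms(2) by (rule shift_diff_multiple_mod_square)
  moreover have "?p ^ (k + 2) dvd (?p ^ Suc k) ^ 2"
    unfolding power_mult[symmetric] by (rule le_imp_power_dvd) simp
  ultimately have "?p ^ (k + 2) dvd
      shift_diff (q * (p ^ k * T)) u n - of_nat q * shift_diff (p ^ k * T) u n"
    by (rule dvd_trans[rotated])
  moreover have "?p ^ (k + 2) dvd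
      of_nat q * (shift_diff (p ^ k * T) u n - ?p ^ k * shift_diff T u n)"
    using shift_diff_power_multiple[OF assms] by (rule dvd_mult)
  ultimately have "?p ^ (k + 2) dvd
      (shift_diff (q * (p ^ k * T)) u n - of_nat q * shift_diff (p ^ k * T) u n) +
      of_nat q * (shift_diff (p ^ k * T) u n - ?p ^ k * shift_diff T u n)"
    by (rule dvd_add)
  then show ?thesis
    by (simp add: right_diff_distrib mult.assoc)
qed

lemma dvd_at_mod_period_iff:
  fixes d :: "'a::idom"
  assumes "period_mod cs d T" and "linear_recurrence cs u"
  shows "d dvd u (n mod T) \<longleftrightarrow> d dvd u n"
proof -
  have "d dvd u (n mod T + n div T * T) - u (n mod T)"
    using newton_truncated_mod_power[OF assms, of 1 "n mod T" "n div T"] by simp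
  then have "d dvd u n - u (n mod T)"
    by simp
  then show ?thesis
    by (metis diff_add_cancel dvd_add_right_iff)
qed

section \<open>Simple zeros modulo powers of an odd prime\<close>

lemma dvd_multiplier_of_simple_zero:
  fixes u :: "nat \<Rightarrow> int"
  assumes "period_mod cs (int p) T" and "linear_recurrence cs u" and "prime p" and "odd p"
    and "u r = 0" and "\<not> int p ^ 2 dvd u (r + T)"
    and "int p ^ (k + 2) dvd u (r + q * (p ^ k * T))"
  shows "p dvd q"
proof -
  let ?p = "int p"
  have "?p ^ (k + 2) dvd u (r + q * (p ^ k * T)) - int (q * p ^ k) * u (r + T)"
    using shift_diff_power_times_multiple[OF assms(1,2,4), of k q r] \<open>u r = 0\<close>
    by (simp add: shift_diff_def)
  then have "?p ^ (k + 2) dvd int (q * p ^ k) * u (r + T)"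
    using assms(7) by (simp add: dvd_diff_right_iff)
  then have "?p ^ k * ?p ^ 2 dvd ?p ^ k * (int q * u (r + T))"
    by (simp only: power_add of_nat_mult of_nat_power ac_simps)
  moreover have "?p ^ k \<noteq> 0"
    using \<open>prime p\<close> by auto
  ultimately have square_dvd: "?p ^ 2 dvd int q * u (r + T)"
    by (simp only: dvd_mult_cancel_left) simp
  have "?p dvd u (r + T)"
    using period_modD[OF assms(1,2), of r] \<open>u r = 0\<close> by (simp add: shift_diff_def)
  then obtain c where c: "u (r + T) = ?p * c" ..
  then have "?p dvd int q * c"
    using square_dvd \<open>prime p\<close> by (auto simp: power2_eq_square mult.left_commute)
  moreover have "\<not> ?p dvd c"
    using assms(6) c by (auto simp: power2_eq_square)
  ultimately show ?thesis
    using \<open>prime p\<close> by (simp add: prime_dvd_mult_iff)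
qed

lemma simple_zeros_mod_prime_power:
  fixes u :: "nat \<Rightarrow> int"
  assumes period: "period_mod cs (int p) T" "T > 0"
    and rec: "linear_recurrence cs u"
    and p: "prime p" "odd p"
    and simple: "\<And>r. r < T \<Longrightarrow> int p dvd u r \<Longrightarrow> u r = 0 \<and> \<not> int p ^ 2 dvd u (r + T)"
    and power_dvd: "int p ^ Suc k dvd u n"
  shows "\<exists>r<T. u r = 0 \<and> n mod (p ^ k * T) = r"
  using power_dvd
proof (induction k)
  case 0
  then have "int p dvd u (n mod T)"
    using dvd_at_mod_period_iff[OF period(1) rec] by simp
  then show ?case
    using simple period(2) by auto
next
  case (Suc k)
  let ?P = "p ^ k * T"
  have "int p ^ Suc k dvd u n"
    using Suc.prems by (rule power_le_dvd) simp
  then obtain r where r: "r < T" "u r = 0" "n mod ?P = r"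
    using Suc.IH by blast
  define q where "q = n div ?P"
  have n: "n = r + q * ?P"
    using r(3) unfolding q_def by (metis mod_div_decomp add.commute)
  have "p dvd q"
    using simple[OF r(1)] r(2) Suc.prems n
    by (intro dvd_multiplier_of_simple_zero[OF period(1) rec p r(2)]) auto
  then obtain q' where "q = p * q'" ..
  then have "n = r + q' * (p ^ Suc k * T)"
    using n by simp
  moreover have "r < p ^ Suc k * T"
  proof -
    have "1 * T \<le> p ^ Suc k * T"
      using prime_gt_0_nat[OF p(1)] by (intro mult_le_mono1 one_le_power) simp
    with r(1) show ?thesis by linarith
  qed
  ultimately show ?case
    using r by simp
qed

section \<open>The sequence modulo powers of 5\<close>

text \<open>Starting one index earlier, at \<open>x\<^sub>-\<^sub>1 = 0\<close>, puts both zeros at nonnegative indices.\<close>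

definition x_seq_from_neg1 :: "nat \<Rightarrow> int" where
  "x_seq_from_neg1 = case_nat 0 (\<lambda>n. int (x_seq n))"

lemma x_seq_from_neg1_simps [simp]:
  "x_seq_from_neg1 0 = 0" "x_seq_from_neg1 (Suc n) = int (x_seq n)"
  by (simp_all add: x_seq_from_neg1_def)

lemma x_seq_from_neg1_numeral [simp]:
  "x_seq_from_neg1 (numeral v) = int (x_seq (pred_numeral v))"
  by (simp add: numeral_eq_Suc)

lemma linear_recurrence_x_seq_from_neg1: "linear_recurrence [1, 2, 2] x_seq_from_neg1"
  unfolding linear_recurrence_def
proof
  fix n
  show "x_seq_from_neg1 (n + length [1, 2, 2 :: int]) =
    (\<Sum>i<length [1, 2, 2 :: int]. [1, 2, 2] ! i * x_seq_from_neg1 (n + i))"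
    by (cases n) simp_all
qed

lemma period_mod_5: "period_mod [1, 2, 2] (5::int) 8"
  unfolding period_mod_def
proof (intro allI impI)
  fix u :: "nat \<Rightarrow> int" and n
  assume "linear_recurrence [1, 2, 2] u"
  then have rec: "u (i + 3) = 2 * u (i + 2) + 2 * u (i + 1) + u i" for i
    by (simp add: linear_recurrence_def numeral_eq_Suc)
  have "shift_diff 8 u n = 5 * (27 * u n + 64 * u (n + 1) + 77 * u (n + 2))"
    using rec[of n] rec[of "n + 1"] rec[of "n + 2"] rec[of "n + 3"] rec[of "n + 4"] rec[of "n + 5"]
    by (simp add: shift_diff_def numeral_eq_Suc)
  then show "5 dvd shift_diff 8 u n" by simp
qed

lemma x_seq_add_3: "x_seq (n + 3) = 2 * x_seq (n + 2) + 2 * x_seq (n + 1) + x_seq n"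
  by (simp add: numeral_eq_Suc)

lemma x_seq_values:
  "x_seq 2 = 2" "x_seq 3 = 6" "x_seq 4 = 17" "x_seq 5 = 48" "x_seq 6 = 136" "x_seq 7 = 385"
  "x_seq 8 = 1090" "x_seq 9 = 3086" "x_seq 10 = 8737" "x_seq 11 = 24736" "x_seq 12 = 70032"
  "x_seq 13 = 198273" "x_seq 14 = 561346"
  using x_seq.simps(3)[folded numeral_2_eq_2] x_seq_add_3[of 0] x_seq_add_3[of 1] x_seq_add_3[of 2]
    x_seq_add_3[of 3] x_seq_add_3[of 4] x_seq_add_3[of 5] x_seq_add_3[of 6] x_seq_add_3[of 7]
    x_seq_add_3[of 8] x_seq_add_3[of 9] x_seq_add_3[of 10] x_seq_add_3[of 11]
  by simp_all

lemma x_seq_zeros_mod_power_5: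
  assumes "5 ^ Suc k dvd x_seq n"
  shows "8 * 5 ^ k dvd n \<or> 8 * 5 ^ k dvd n + 1"
proof -
  let ?u = x_seq_from_neg1 and ?P = "5 ^ k * 8 :: nat"
  have power_dvd: "int 5 ^ Suc k dvd ?u (n + 1)"
    using assms by (simp add: int_dvd_int_iff[of "5 ^ Suc k" "x_seq n", simplified])
  have zero_mod_5: "r = 0 \<or> r = 1" if "r < 8" "int 5 dvd ?u r" for r
  proof -
    have "r \<in> {0, 1, 2, 3, 4, 5, 6, 7}"
      using that(1) by auto
    then show ?thesis
      using that(2) by (auto simp: x_seq_values)
  qed
  have simple: "?u r = 0 \<and> \<not> int 5 ^ 2 dvd ?u (r + 8)" if "r < 8" "int 5 dvd ?u r" for r
    using zero_mod_5[OF that] by (auto simp: x_seq_values)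
  obtain r where r: "r < 8" "?u r = 0" "(n + 1) mod ?P = r"
    using simple_zeros_mod_prime_power[OF _ _ linear_recurrence_x_seq_from_neg1 _ _ simple power_dvd]
      period_mod_5 by auto
  then have "r = 0 \<or> r = 1"
    using zero_mod_5[of r] by auto
  moreover have "?P dvd n + 1 - r"
    unfolding r(3)[symmetric] by (rule dvd_minus_mod)
  ultimately show ?thesis
    by (auto simp: mult.commute)
qed

section \<open>Growth of the sequence and of factorials\<close>

lemma double_x_seq_le_x_seq_Suc: "2 * x_seq n \<le> x_seq (Suc n)"
  by (cases n rule: x_seq.cases) simp_all

lemma mono_x_seq: "mono x_seq"
  unfolding mono_iff_le_Suc using double_x_seq_le_x_seq_Suc by (metis le_add1 le_trans mult_2)

lemma power_2_Suc_le_x_seq: "2 ^ Suc n \<le> x_seq n" if "n \<ge> 6"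
  using that
proof (induction n rule: dec_induct)
  case base
  then show ?case by (simp add: x_seq_values)
next
  case (step n)
  then show ?case using double_x_seq_le_x_seq_Suc[of n] by simp
qed

lemma power_dvd_fact_mult:
  assumes "m > 0"
  shows "m ^ k dvd (fact (m * k) :: nat)"
proof (induction k)
  case 0
  then show ?case by simp
next
  case (Suc k)
  have "fact (m * k) dvd (fact (m * Suc k - 1) :: nat)"
    using assms by (intro fact_dvd) simp
  with Suc have "m * m ^ k dvd m * Suc k * fact (m * Suc k - 1)"
    by (intro mult_dvd_mono) (auto intro: dvd_trans)
  also have "\<dots> = fact (m * Suc k)"
    using assms by (subst fact_reduce[of "m * Suc k"]) auto
  finally show ?case by simp
qed

lemma fact_add_le: "fact (n + k) \<le> (n + k) ^ k * (fact n :: nat)"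
proof -
  have "fact (n + k) = fact (n + k) div fact n * (fact n :: nat)"
    by (simp add: fact_dvd)
  also have "\<dots> \<le> (n + k) ^ k * fact n"
    using fact_div_fact_le_pow[of k "n + k"] by simp
  finally show ?thesis .
qed

lemma fact_less_power_2_power_5: "fact (5 * j + 14) < (2::nat) ^ (40 * 5 ^ j)"
proof (induction j)
  case 0
  show ?case by (simp add: fact_numeral)
next
  case (Suc j)
  have "j < 5 ^ j"
    by (rule power_gt_expt) simp
  then have "5 * j + 19 \<le> 32 * 5 ^ j"
    by linarith
  also have "\<dots> < 2 ^ (32 * 5 ^ j)"
    by (rule less_exp)
  finally have base: "5 * j + 19 \<le> (2::nat) ^ (32 * 5 ^ j)"
    by simp
  have "fact (5 * Suc j + 14) \<le> (5 * j + 19) ^ 5 * (fact (5 * j + 14) :: nat)"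
    using fact_add_le[of "5 * j + 14" 5] by (simp add: ac_simps)
  also have "\<dots> < (2 ^ (32 * 5 ^ j)) ^ 5 * 2 ^ (40 * 5 ^ j)"
    using power_mono[OF base, of 5] Suc by (intro mult_le_less_imp_less) auto
  also have "\<dots> = 2 ^ (40 * 5 ^ Suc j)"
    by (simp flip: power_mult power_add)
  finally show ?case .
qed

section \<open>Factorials in the sequence\<close>

lemma x_seq_eq_fact_imp_less_10:
  assumes "n > 0" and "x_seq n = fact m"
  shows "m < 10"
proof (rule ccontr)
  assume "\<not> m < 10"
  define j where "j = m div 5 - 2"
  have m: "5 * (j + 2) \<le> m" "m \<le> 5 * j + 14"
    using \<open>\<not> m < 10\<close> unfolding j_def by presburger+
  have "5 ^ Suc (j + 1) dvd x_seq n"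
    using power_dvd_fact_mult[of 5 "j + 2"] fact_dvd[OF m(1)] assms(2) by (auto intro: dvd_trans)
  then have "8 * 5 ^ (j + 1) dvd n \<or> 8 * 5 ^ (j + 1) dvd n + 1"
    by (rule x_seq_zeros_mod_power_5)
  then have exponent: "40 * 5 ^ j \<le> n + 1"
    using assms(1) by (auto dest!: dvd_imp_le)
  have "fact m \<le> (fact (5 * j + 14) :: nat)"
    using m(2) by (rule fact_mono_nat)
  also have "\<dots> < 2 ^ (40 * 5 ^ j)"
    by (rule fact_less_power_2_power_5)
  also have "\<dots> \<le> 2 ^ (n + 1)"
    using exponent by (rule power_increasing) simp
  also have "\<dots> \<le> x_seq n"
  proof -
    have "(40::nat) \<le> 40 * 5 ^ j" by simp
    with exponent have "6 \<le> n" by linarith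
    then show ?thesis using power_2_Suc_le_x_seq[of n] by simp
  qed
  finally show False using assms(2) by simp
qed

lemma x_seq_eq_fact_less_10:
  assumes "n > 0" and "m > 0" and "x_seq n = fact m" and "m < 10"
  shows "(n, m) \<in> {(1, 1), (2, 2), (3, 3)}"
proof -
  have "x_seq n \<le> fact 9"
    using assms(3,4) fact_mono_nat[of m 9] by simp
  also have "\<dots> < x_seq 14"
    by (simp add: x_seq_values fact_numeral)
  finally have "n < 14"
    using mono_x_seq by (meson leD monoD not_le_imp_less)
  then have "n \<in> {1, 2, 3, 4, 5, 6, 7, 8, 9, 10, 11, 12, 13}"
    using assms(1) by (simp only: insert_iff empty_iff) presburger
  moreover have "m \<in> {1, 2, 3, 4, 5, 6, 7, 8, 9}"
    using assms(2,4) by auto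
  ultimately show ?thesis
    using assms(3)
    by (elim insertE emptyE) (simp_all add: x_seq_values fact_numeral)
qed

theorem theorem1p11:
  "{(n :: nat, m :: nat). n > 0 \<and> m > 0 \<and> x_seq n = fact m} = {(1, 1), (2, 2), (3, 3)}"
proof
  show "{(n, m). n > 0 \<and> m > 0 \<and> x_seq n = fact m} \<subseteq> {(1, 1), (2, 2), (3, 3)}"
    using x_seq_eq_fact_imp_less_10 x_seq_eq_fact_less_10 by blast
  show "{(1, 1), (2, 2), (3, 3)} \<subseteq> {(n, m). n > 0 \<and> m > 0 \<and> x_seq n = fact m}"
    by (simp add: x_seq_values fact_numeral)
qed

end
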